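(* Let $H$ be any non-trivial group and let $X$ be a compact Hausdorff space containing an open subset homeomorphic to $(0,1)^n$ for some non-zero $n\in\omega\cup\{\omega\}$ (notice that the listed examples, namely the spaces $[0,1]^n$, $S^n$ ($n$-dimensional sphere) and $(S^1)^n$ for $n\in\omega\cup\{\omega\}$, satisfy this assumption). Then there is no Hausdorff group topology on $H(X)$ under which the action of $Homeo(X)$ on $H(X)$ is continuous (where $Homeo(X)$ is considered with the compact-open topology).
   Context: $Homeo(X)$ is the group of all homeomorphisms of $X$ onto itself. For a group $H$ and a set $X$, for each $x\in X$ let $H_x=\{h_x:h\in H\}$ be an isomorphic copy of $H$ (via $h\mapsto h_x$), and let $H(X)=\bigoplus_{x\in X}H_x$ be the (restricted) direct sum. Its group operation is written $+$, although $H(X)$ need not be commutative. If a group $G$ acts on $X$, then $G$ acts on $H(X)$ as automorphisms by $$g\big((h_1)_{x_1}+\dots+(h_n)_{x_n}\big)=(h_1)_{gx_1}+\dots+(h_n)_{gx_n}$$ for $h_1,\dots,h_n\in H$ and pairwise distinct $x_1,\dots,x_n\in X$; here $G=Homeo(X)$ with its natural action on $X$. A group topology is a topology for which multiplication and inversion are continuous. Continuity of the action means joint continuity of $Homeo(X)\times H(X)\to H(X)$. The examples listed in the parenthetical remark are spaces $X$ for which the paper says that $(X,Homeo(X))$ is a small Polish structure. A Polish structure is a pair $(X,G)$, where $G$ is a Polish group acting faithfully on a set $X$ so that the stabilizers of all singletons are closed subgroups of $G$; it is small if for every $n<\omega$ there are only countably many orbits on $X^n$ under the action of $G$.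
   Formalization: The remark that the examples [0,1]^n, S^n, (S^1)^n satisfy the assumption is stated only for finite n>0: for n=0 they are finite discrete spaces, and for n=ω the compact spaces [0,1]^ω, (S^1)^ω have no open subset homeomorphic to a (0,1)^k (S^ω has no suitable compact reading). *)

theory Defs
  imports
    "HOL-Analysis.Analysis"
    "HOL-Algebra.Bij"
    "HOL-Algebra.Product_Groups"
    "HOL-Library.Extended_Nat"
begin

section \<open>The homeomorphism group with the compact-open topology\<close>

text \<open>Maps on a space are represented by functions that are extensional on its carrier,
  so that distinct elements are distinct as maps.\<close>

definition continuous_functions :: "'a topology \<Rightarrow> 'b topology \<Rightarrow> ('a \<Rightarrow> 'b) set"
  where "continuous_functions X Y = {f \<in> extensional (topspace X). continuous_map X Y f}"

definition compact_open_topology :: "'a topology \<Rightarrow> 'b topology \<Rightarrow> ('a \<Rightarrow> 'b) topology"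
  where "compact_open_topology X Y =
    topology_generated_by
      {{f \<in> continuous_functions X Y. f ` K \<subseteq> U} | K U. compactin X K \<and> openin Y U}"

definition Homeo :: "'a topology \<Rightarrow> ('a \<Rightarrow> 'a) set"
  where "Homeo X = {g \<in> extensional (topspace X). homeomorphic_map X X g}"

definition Homeo_group :: "'a topology \<Rightarrow> ('a \<Rightarrow> 'a) monoid"
  where "Homeo_group X = (BijGroup (topspace X))\<lparr>carrier := Homeo X\<rparr>"

definition Homeo_topology :: "'a topology \<Rightarrow> ('a \<Rightarrow> 'a) topology"
  where "Homeo_topology X = subtopology (compact_open_topology X X) (Homeo X)"

lemma Homeo_subset_continuous_functions: "Homeo X \<subseteq> continuous_functions X X"
  by (auto simp: Homeo_def continuous_functions_def homeomorphic_imp_continuous_map)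

lemma topspace_compact_open_topology:
  "topspace (compact_open_topology X Y) = continuous_functions X Y"
proof -
  have "continuous_functions X Y
      \<in> {{f \<in> continuous_functions X Y. f ` K \<subseteq> U} | K U. compactin X K \<and> openin Y U}"
    by (rule CollectI, rule exI[of _ "{}"], rule exI[of _ "{}"]) auto
  then show ?thesis
    unfolding compact_open_topology_def topology_generated_by_topspace by blast
qed

lemma topspace_Homeo_topology: "topspace (Homeo_topology X) = Homeo X"
  using Homeo_subset_continuous_functions
  by (auto simp: Homeo_topology_def topspace_compact_open_topology)

lemma Homeo_imp_Bij: "g \<in> Homeo X \<Longrightarrow> g \<in> Bij (topspace X)"
  by (auto simp: Homeo_def Bij_def bij_betw_def homeomorphic_imp_surjective_map
      dest: homeomorphic_imp_injective_map)

lemma subgroup_Homeo: "subgroup (Homeo X) (BijGroup (topspace X))"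
proof (rule group.subgroupI[OF group_BijGroup])
  show "Homeo X \<subseteq> carrier (BijGroup (topspace X))"
    using Homeo_imp_Bij by (auto simp: BijGroup_def)
  have "homeomorphic_map X X (\<lambda>x\<in>topspace X. x)"
    by (rule homeomorphic_map_eq[of _ _ id]) auto
  then have "(\<lambda>x\<in>topspace X. x) \<in> Homeo X"
    by (simp add: Homeo_def)
  then show "Homeo X \<noteq> {}"
    by blast
next
  fix g assume g: "g \<in> Homeo X"
  obtain h where h: "homeomorphic_maps X X g h"
    using g by (auto simp: Homeo_def homeomorphic_map_maps)
  have "inv_into (topspace X) g y = h y" if "y \<in> topspace X" for y
    using h that Homeo_imp_Bij[OF g]
    by (intro inv_into_f_eq)
       (auto simp: homeomorphic_maps_def continuous_map_def Bij_def bij_betw_def)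
  moreover have "homeomorphic_map X X h"
    using h by (simp add: homeomorphic_maps_map)
  ultimately have "homeomorphic_map X X (\<lambda>y\<in>topspace X. inv_into (topspace X) g y)"
    by (simp add: homeomorphic_map_eq[of X X h])
  then show "inv\<^bsub>BijGroup (topspace X)\<^esub> g \<in> Homeo X"
    using g by (simp add: inv_BijGroup Homeo_imp_Bij Homeo_def)
next
  fix g h assume g: "g \<in> Homeo X" and h: "h \<in> Homeo X"
  have "homeomorphic_map X X (g \<circ> h)"
    using g h homeomorphic_map_compose[of X X h X g] by (simp add: Homeo_def)
  then have "homeomorphic_map X X (compose (topspace X) g h)"
    by (rule homeomorphic_map_eq) (simp add: compose_def)
  then show "g \<otimes>\<^bsub>BijGroup (topspace X)\<^esub> h \<in> Homeo X"
    using g h by (simp add: BijGroup_def Homeo_imp_Bij) (simp add: Homeo_def)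
qed

lemma group_Homeo_group: "group (Homeo_group X)"
  unfolding Homeo_group_def
  by (rule subgroup.subgroup_is_group[OF subgroup_Homeo group_BijGroup])


section \<open>The direct sum of copies of a group and the induced action\<close>

text \<open>An element \<open>(h\<^sub>1)\<^sub>x\<^sub>1 + \<dots> + (h\<^sub>n)\<^sub>x\<^sub>n\<close> of \<open>H(X)\<close> is the finitely supported function
  sending each \<open>x\<^sub>i\<close> to \<open>h\<^sub>i\<close> and all other points to the identity of \<open>H\<close>.\<close>

definition copies_sum :: "('h, 'm) monoid_scheme \<Rightarrow> 'a topology \<Rightarrow> ('a \<Rightarrow> 'h) monoid"
  where "copies_sum H X = sum_group (topspace X) (\<lambda>_. H)"

text \<open>The coefficient of \<open>g u\<close> at \<open>g x\<close> is that of \<open>u\<close> at \<open>x\<close>.\<close>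

definition translate :: "'a topology \<Rightarrow> ('a \<Rightarrow> 'a) \<Rightarrow> ('a \<Rightarrow> 'h) \<Rightarrow> ('a \<Rightarrow> 'h)"
  where "translate X g u = (\<lambda>y\<in>topspace X. u (inv_into (topspace X) g y))"

lemma translate_apply:
  assumes "g \<in> Homeo X" "x \<in> topspace X"
  shows "translate X g u (g x) = u x"
  using Homeo_imp_Bij[OF assms(1)] assms(2)
  by (auto simp: translate_def Bij_def bij_betw_def)

definition in_copy :: "('h, 'm) monoid_scheme \<Rightarrow> 'a topology \<Rightarrow> 'a \<Rightarrow> 'h \<Rightarrow> ('a \<Rightarrow> 'h)"
  where "in_copy H X x h = (\<lambda>y\<in>topspace X. if y = x then h else \<one>\<^bsub>H\<^esub>)"

lemma translate_in_copy:
  assumes "g \<in> Homeo X" "x \<in> topspace X"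
  shows "translate X g (in_copy H X x h) = in_copy H X (g x) h"
proof
  fix y
  show "translate X g (in_copy H X x h) y = in_copy H X (g x) h y"
  proof (cases "y \<in> topspace X")
    case True
    then obtain z where "z \<in> topspace X" "y = g z"
      using Homeo_imp_Bij[OF assms(1)] by (auto simp: Bij_def bij_betw_def)
    then show ?thesis
      using True assms Homeo_imp_Bij[OF assms(1)]
      by (auto simp: translate_apply in_copy_def Bij_def bij_betw_def inj_on_def)
  qed (simp add: translate_def in_copy_def)
qed

lemma translate_hom:
  assumes "group H" "g \<in> Homeo X"
  shows "translate X g \<in> hom (copies_sum H X) (copies_sum H X)"
proof (rule homI)
  have bij: "bij_betw g (topspace X) (topspace X)"
    using Homeo_imp_Bij[OF assms(2)] by (simp add: Bij_def)
  then have inv: "inv_into (topspace X) g y \<in> topspace X" if "y \<in> topspace X" for y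
    using that by (auto simp: bij_betw_def intro: inv_into_into)
  fix u assume u: "u \<in> carrier (copies_sum H X)"
  have "{y \<in> topspace X. u (inv_into (topspace X) g y) \<noteq> \<one>\<^bsub>H\<^esub>}
      \<subseteq> g ` {x \<in> topspace X. u x \<noteq> \<one>\<^bsub>H\<^esub>}"
    using bij inv by (force simp: bij_betw_def f_inv_into_f image_iff)
  moreover have "finite {x \<in> topspace X. u x \<noteq> \<one>\<^bsub>H\<^esub>}"
    using u assms by (simp add: copies_sum_def carrier_sum_group)
  ultimately have "finite {y \<in> topspace X. u (inv_into (topspace X) g y) \<noteq> \<one>\<^bsub>H\<^esub>}"
    by (meson finite_imageI finite_subset)
  then show "translate X g u \<in> carrier (copies_sum H X)"
    using u inv assms
    by (auto simp: copies_sum_def carrier_sum_group translate_def PiE_def Pi_def cong: conj_cong)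
  fix v
  show "translate X g (u \<otimes>\<^bsub>copies_sum H X\<^esub> v)
      = translate X g u \<otimes>\<^bsub>copies_sum H X\<^esub> translate X g v"
    using inv by (auto simp: copies_sum_def translate_def)
qed


section \<open>Group topologies\<close>

definition group_topology :: "('g, 'm) monoid_scheme \<Rightarrow> 'g topology \<Rightarrow> bool"
  where "group_topology G T \<longleftrightarrow>
    topspace T = carrier G \<and>
    continuous_map (prod_topology T T) T (\<lambda>(u, v). u \<otimes>\<^bsub>G\<^esub> v) \<and>
    continuous_map T T (\<lambda>u. inv\<^bsub>G\<^esub> u)"


section \<open>Cubes and tori\<close>

definition open_cube :: "enat \<Rightarrow> (nat \<Rightarrow> real) topology"
  where "open_cube n = product_topology (\<lambda>_. top_of_set {0<..<1}) {i. enat i < n}"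

text \<open>The case \<open>n = \<infinity>\<close> is allowed, but no compact Hausdorff space has such an open subset:
  open subsets of a compact Hausdorff space are locally compact, while \<open>(0,1)\<^sup>\<omega>\<close> is not. In
  particular the Hilbert cube \<open>[0,1]\<^sup>\<omega>\<close> does not satisfy the following predicate.\<close>

definition contains_open_cube :: "'a topology \<Rightarrow> bool"
  where "contains_open_cube X \<longleftrightarrow>
    (\<exists>n::enat. n \<noteq> 0 \<and> (\<exists>U. openin X U \<and> subtopology X U homeomorphic_space open_cube n))"

definition closed_cube :: "nat \<Rightarrow> (nat \<Rightarrow> real) topology"
  where "closed_cube n = product_topology (\<lambda>_. top_of_set {0..1}) {..<n}"

definition torus :: "nat \<Rightarrow> (nat \<Rightarrow> nat \<Rightarrow> real) topology"
  where "torus n = product_topology (\<lambda>_. nsphere 1) {..<n}"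

end

theory Submission
  imports Defs
begin

text \<open>
  Fix \<open>h \<noteq> \<one>\<close> in \<open>H\<close> and an arc \<open>point t\<close>, \<open>t \<in> \<real>\<close>, in the open cube, and write \<open>h\<^sub>t\<close> for the copy of \<open>h\<close> at
  \<open>point t\<close>. Suppose that \<open>H(X)\<close> has a group topology for which the action is continuous. The
  non-zero element \<open>h\<^sub>0 - h\<^sub>1\<close> then lies in every neighbourhood of zero, so that the topology is not
  Hausdorff.

  The reason is that homeomorphisms close to the identity in the compact-open topology may distort
  the arc by an arbitrarily large factor, provided that no point moves far. By continuity of the
  action, \<open>h\<^sub>p - h\<^sub>q\<close> is close to zero if \<open>q\<close> is close to \<open>p\<close>. So, given a neighbourhood \<open>W'\<close> of zero
  and any number \<open>m\<close> of points \<open>p\<^sub>i\<close>, there are \<open>q\<^sub>i > p\<^sub>i\<close> such that the sum of all \<open>h\<^bsub>p\<^sub>i\<^esub> - h\<^bsub>q\<^sub>i\<^esub>\<close> is in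
  \<open>W'\<close>. If the \<open>p\<^sub>i\<close> have distance \<open>2 d\<close>, one homeomorphism that moves no point by more than \<open>2 d\<close>
  carries every \<open>q\<^sub>i\<close> to \<open>p\<^sub>i + d\<close> and fixes the \<open>p\<^sub>i\<close>. Continuity of the action at the pair (identity,
  zero) therefore yields: for every neighbourhood \<open>W\<close> of zero, all sums of \<open>h\<^bsub>p\<^sub>i\<^esub> - h\<^bsub>p\<^sub>i + d\<^esub>\<close> are in \<open>W\<close> once
  \<open>d\<close> is small, regardless of their number (lemma \<open>grid_dipoles\<close>). Two such sums, one shifted
  by \<open>d\<close> against the other, telescope to \<open>h\<^sub>0 - h\<^sub>1\<close> (lemma \<open>long_dipole\<close>).

  The homeomorphisms are made in a chart of the form line times \<open>Y\<close>, by moving the points along the lines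
  with a strength that is cut off in the direction of \<open>Y\<close>. The cutoff functions come from Urysohn's lemma in
  the locally compact space \<open>Y\<close>, and Wallace's tube theorem shows that small motions of the line give
  homeomorphisms near the identity (lemma \<open>slide_near_id\<close>).
\<close>

section \<open>Stretching the line\<close>

text \<open>The piecewise linear homeomorphism of the line that moves \<open>p\<close> to \<open>q\<close> and is the identity outside
\<open>(l, r)\<close>. The two affine maps are the lines through \<open>(l, l)\<close>, \<open>(p, q)\<close> and through \<open>(p, q)\<close>,
\<open>(r, r)\<close>. For \<open>p \<le> q\<close> the broken line is concave, hence the minimum of the two. On \<open>[l, r]\<close> it is not
below the diagonal, and outside it is not above the diagonal, so that the maximum with \<open>t\<close> restores
the identity there. Written like this, continuity and strict monotonicity are inherited from the affine pieces.\<close>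

definition stretch :: "real \<Rightarrow> real \<Rightarrow> real \<Rightarrow> real \<Rightarrow> real \<Rightarrow> real"
  where "stretch l p q r t =
    max t (min (l + (q - l) / (p - l) * (t - l)) (r - (r - q) / (r - p) * (r - t)))"

lemma stretch_bounds:
  assumes "l < p" "p \<le> q" "q < r"
  shows "t \<le> stretch l p q r t" "stretch l p q r t \<le> t + (r - l)"
    and "t \<notin> {l<..<r} \<Longrightarrow> stretch l p q r t = t"
    and "stretch l p q r p = q"
proof -
  have slopes: "(q - l) / (p - l) \<ge> 1" "(r - q) / (r - p) \<ge> 0" "(r - q) / (r - p) \<le> 1"
    using assms by (auto simp: field_simps)
  show "t \<le> stretch l p q r t"
    by (simp add: stretch_def)
  have below: "l + (q - l) / (p - l) * (t - l) \<le> t" if "t \<le> l"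
    using mult_right_mono_neg[OF slopes(1), of "t - l"] that by simp
  have above: "r - (r - q) / (r - p) * (r - t) \<le> t" if "t \<ge> r"
    using mult_right_mono_neg[OF slopes(3), of "r - t"] that by simp
  show outside: "stretch l p q r t = t" if "t \<notin> {l<..<r}"
    using that above below unfolding stretch_def by force
  show "stretch l p q r p = q"
    using assms by (simp add: stretch_def)
  have "r - (r - q) / (r - p) * (r - t) \<le> r" if "t < r"
    using mult_nonneg_nonneg[OF slopes(2), of "r - t"] that by simp
  then have "stretch l p q r t \<le> t + (r - l)" if "t \<in> {l<..<r}"
    using that assms unfolding stretch_def greaterThanLessThan_iff by linarith
  with outside assms show "stretch l p q r t \<le> t + (r - l)"
    by fastforce
qed

lemma strict_mono_stretch:
  assumes "l < p" "p \<le> q" "q < r"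
  shows "strict_mono (stretch l p q r)"
proof (rule strict_monoI)
  fix s t :: real assume st: "s < t"
  have "(q - l) / (p - l) > 0" "(r - q) / (r - p) > 0"
    using assms by auto
  from mult_strict_left_mono[OF _ this(1), of "s - l" "t - l"]
    mult_strict_left_mono[OF _ this(2), of "r - t" "r - s"] st
  show "stretch l p q r s < stretch l p q r t"
    unfolding stretch_def by force
qed

lemma continuous_stretch: "continuous_on UNIV (stretch l p q r)"
  unfolding stretch_def by (intro continuous_intros)

text \<open>The dipoles of the main argument live on the segment \<open>[0, 1]\<close>; the larger window \<open>[-1, 2]\<close> leaves room for
stretching around them. The window is the same for every \<open>\<phi>\<close>, since a single \<open>e\<close> has to serve all
shifts supported in it, and that rests on the compactness of the window.\<close>

definition small_shift :: "real \<Rightarrow> (real \<Rightarrow> real) \<Rightarrow> bool"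
  where "small_shift e \<phi> \<longleftrightarrow> strict_mono \<phi> \<and> continuous_on UNIV \<phi> \<and>
    (\<forall>t. t \<notin> {-1..2} \<longrightarrow> \<phi> t = t) \<and> (\<forall>t. \<bar>\<phi> t - t\<bar> < e)"

lemma small_shift_stretch:
  assumes "l < p" "p \<le> q" "q < r" "r - l < e" "-1 \<le> l" "r \<le> 2"
  shows "small_shift e (stretch l p q r)"
  unfolding small_shift_def
proof (intro conjI allI impI)
  fix t :: real
  show "\<bar>stretch l p q r t - t\<bar> < e"
    using stretch_bounds(1,2)[OF assms(1-3), of t] assms(4) by linarith
  show "stretch l p q r t = t" if "t \<notin> {-1..2}"
    using stretch_bounds(3)[OF assms(1-3), of t] that assms by auto
qed (use assms in \<open>auto intro: strict_mono_stretch continuous_stretch\<close>)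

text \<open>One shift of size at most \<open>2 d\<close> can open many gaps at once: however close \<open>q i\<close> lies to the left
end of the \<open>i\<close>-th interval \<open>[s + 2 i d, s + 2 (i + 1) d]\<close>, it is pushed to the midpoint while the
left end stays fixed. As the intervals do not overlap, the displacement does not grow with their
number. The stretches are combined by taking maxima: each of them is above the identity, and equal
to it off its own interval.\<close>

lemma simultaneous_stretch:
  fixes d :: real and s :: real and q :: "nat \<Rightarrow> real" and m :: nat
  assumes d: "0 < d"
    and q: "\<And>i. i < m \<Longrightarrow> s + 2 * real i * d < q i \<and> q i \<le> s + 2 * real i * d + d"
  shows "\<exists>\<phi>. strict_mono \<phi> \<and> continuous_on UNIV \<phi> \<and>
    (\<forall>t. t \<le> \<phi> t \<and> \<phi> t \<le> t + 2 * d) \<and> (\<forall>t. t \<notin> {s<..<s + 2 * real m * d} \<longrightarrow> \<phi> t = t) \<and>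
    (\<forall>i<m. \<phi> (s + 2 * real i * d) = s + 2 * real i * d \<and> \<phi> (q i) = s + 2 * real i * d + d)"
  using q
proof (induction m)
  case 0
  show ?case
    using d by (intro exI[of _ "\<lambda>t. t"]) (auto simp: strict_mono_def)
next
  case (Suc m)
  then obtain \<phi> where \<phi>: "strict_mono \<phi>" "continuous_on UNIV \<phi>"
    "\<And>t. t \<le> \<phi> t" "\<And>t. \<phi> t \<le> t + 2 * d" "\<And>t. t \<notin> {s<..<s + 2 * real m * d} \<Longrightarrow> \<phi> t = t"
    "\<And>i. i < m \<Longrightarrow> \<phi> (s + 2 * real i * d) = s + 2 * real i * d"
    "\<And>i. i < m \<Longrightarrow> \<phi> (q i) = s + 2 * real i * d + d"
    by (metis less_Suc_eq)
  define l where "l = s + 2 * real m * d"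
  define b where "b = stretch l (q m) (l + d) (l + 2 * d)"
  have lq: "l < q m" "q m \<le> l + d" "l + d < l + 2 * d"
    using Suc.prems[of m] d by (auto simp: l_def)
  have l0: "s \<le> l"
    using d by (simp add: l_def)
  have b: "strict_mono b" "continuous_on UNIV b" "\<And>t. t \<le> b t" "\<And>t. b t \<le> t + 2 * d"
    "\<And>t. t \<notin> {l<..<l + 2 * d} \<Longrightarrow> b t = t" "b (q m) = l + d"
    using strict_mono_stretch[OF lq] continuous_stretch stretch_bounds[OF lq]
    unfolding b_def by force+
  show ?case
  proof (intro exI[of _ "\<lambda>t. max (\<phi> t) (b t)"] conjI allI impI)
    show "strict_mono (\<lambda>t. max (\<phi> t) (b t))"
      using \<phi>(1) b(1) by (auto simp: strict_mono_def max_less_iff_conj intro: less_max_iff_disj[THEN iffD2])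
    show "continuous_on UNIV (\<lambda>t. max (\<phi> t) (b t))"
      using \<phi>(2) b(2) by (intro continuous_intros)
    fix t
    show "t \<le> max (\<phi> t) (b t)" "max (\<phi> t) (b t) \<le> t + 2 * d"
      using \<phi>(3,4)[of t] b(3,4)[of t] by auto
    show "max (\<phi> t) (b t) = t" if "t \<notin> {s<..<s + 2 * real (Suc m) * d}"
    proof -
      have eq: "s + 2 * real (Suc m) * d = l + 2 * d"
        by (simp add: l_def algebra_simps)
      from that have "t \<notin> {s<..<l + 2 * d}"
        unfolding eq .
      then have "t \<notin> {s<..<l}" "t \<notin> {l<..<l + 2 * d}"
        using d l0 by auto
      then show ?thesis
        using \<phi>(5)[of t] b(5)[of t] by (simp add: l_def)
    qed
  next
    fix i assume i: "i < Suc m"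
    have left: "s + 2 * real i * d + 2 * d \<le> l" if "i < m"
    proof -
      have "real i + 1 \<le> real m" using that by linarith
      from mult_right_mono[OF this, of d] d show ?thesis by (simp add: l_def algebra_simps)
    qed
    show "max (\<phi> (s + 2 * real i * d)) (b (s + 2 * real i * d)) = s + 2 * real i * d"
    proof (cases "i < m")
      case True
      then show ?thesis using left \<phi>(6) b(5)[of "s + 2 * real i * d"] d by auto
    next
      case False
      then have "i = m" using i by simp
      then show ?thesis using \<phi>(5)[of l] b(5)[of l] by (simp add: l_def)
    qed
    show "max (\<phi> (q i)) (b (q i)) = s + 2 * real i * d + d"
    proof (cases "i < m")
      case True
      have "q i < l" using left[OF True] Suc.prems[of i] i d by auto
      then have "b (q i) = q i" by (simp add: b(5))
      then show ?thesis using \<phi>(3)[of "q i"] \<phi>(7)[OF True] by simp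
    next
      case False
      then have "i = m" using i by simp
      then show ?thesis using \<phi>(5)[of "q m"] b(6) lq by (simp add: l_def)
    qed
  qed
qed

section \<open>Sliding along a slab\<close>

text \<open>An open set \<open>U\<close> with product coordinates \<open>(t, y)\<close>, where \<open>t\<close> ranges over the line, and a cutoff
function \<open>\<rho>\<close> on the transversal \<open>Y\<close>. The argument takes place along the single arc \<open>y = y\<^sub>0\<close>, and \<open>\<rho>\<close>
serves to extend motions of that arc to the whole space.\<close>

locale flow_box =
  fixes X :: "'a topology" and Y :: "'b topology"
    and U :: "'a set" and \<psi> :: "real \<times> 'b \<Rightarrow> 'a"
    and \<rho> :: "'b \<Rightarrow> real" and L :: "'b set" and y\<^sub>0 :: 'b
  assumes compact_X: "compact_space X" and Hausdorff_X: "Hausdorff_space X"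
    and open_U: "openin X U"
    and chart: "homeomorphic_map (prod_topology euclideanreal Y) (subtopology X U) \<psi>"
    and y\<^sub>0: "y\<^sub>0 \<in> topspace Y" and \<rho>_y\<^sub>0: "\<rho> y\<^sub>0 = 1"
    and continuous_\<rho>: "continuous_map Y euclideanreal \<rho>"
    and \<rho>_range: "y \<in> topspace Y \<Longrightarrow> 0 \<le> \<rho> y \<and> \<rho> y \<le> 1"
    and compact_L: "compactin Y L"
    and \<rho>_outside: "y \<in> topspace Y - L \<Longrightarrow> \<rho> y = 0"
begin

abbreviation "strip \<equiv> prod_topology euclideanreal Y"

text \<open>On the line over \<open>y\<close> the shift \<open>\<phi>\<close> is applied with strength \<open>\<rho> y\<close>: in full over \<open>y\<^sub>0\<close>, and not at all
outside the compact set \<open>L\<close>. Hence \<open>slide \<phi>\<close> is the identity off a compact subset of \<open>U\<close>.\<close>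

definition shear :: "(real \<Rightarrow> real) \<Rightarrow> real \<times> 'b \<Rightarrow> real \<times> 'b"
  where "shear \<phi> = (\<lambda>(t, y). (t + \<rho> y * (\<phi> t - t), y))"

definition slide :: "(real \<Rightarrow> real) \<Rightarrow> 'a \<Rightarrow> 'a"
  where "slide \<phi> = (\<lambda>x\<in>topspace X.
    if x \<in> U then \<psi> (shear \<phi> (inv_into (topspace strip) \<psi> x)) else x)"

lemma U_subset: "U \<subseteq> topspace X"
  using open_U by (rule openin_subset)

lemma inj_chart: "inj_on \<psi> (topspace strip)"
  using chart by (rule homeomorphic_imp_injective_map)

lemma image_chart: "\<psi> ` topspace strip = U"
  using homeomorphic_imp_surjective_map[OF chart] U_subset by auto

lemma chart_eq_iff:
  "p \<in> topspace strip \<Longrightarrow> p' \<in> topspace strip \<Longrightarrow> \<psi> p = \<psi> p' \<longleftrightarrow> p = p'"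
  using inj_chart by (meson inj_on_eq_iff)

lemma chart_in_U: "p \<in> topspace strip \<Longrightarrow> \<psi> p \<in> U"
  using image_chart by blast

lemma continuous_chart: "continuous_map strip X \<psi>"
  using homeomorphic_imp_continuous_map[OF chart] continuous_map_in_subtopology by blast

lemma open_chart: "openin strip O' \<Longrightarrow> openin X (\<psi> ` O')"
  using homeomorphic_imp_open_map[OF chart] open_U
  by (meson open_map_def openin_trans_full)

lemma slide_chart: "p \<in> topspace strip \<Longrightarrow> slide \<phi> (\<psi> p) = \<psi> (shear \<phi> p)"
  using chart_in_U[of p] U_subset inj_chart by (auto simp: slide_def inv_into_f_f)

lemma slide_outside: "x \<in> topspace X - U \<Longrightarrow> slide \<phi> x = x"
  by (simp add: slide_def)

lemma shear_in_strip: "p \<in> topspace strip \<Longrightarrow> shear \<phi> p \<in> topspace strip"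
  by (auto simp: shear_def)

abbreviation "slab \<equiv> {-1..2} \<times> L"

lemma compact_slab: "compactin strip slab"
  using compact_L by (auto simp: compactin_Times)

lemma slab_subset: "slab \<subseteq> topspace strip"
  using compact_slab by (rule compactin_subset_topspace)

lemma closed_slab_image: "closedin X (\<psi> ` slab)"
  using compact_slab continuous_chart Hausdorff_X
  by (meson compactin_imp_closedin image_compactin)

lemma shear_outside_slab:
  assumes "small_shift e \<phi>" "p \<in> topspace strip - slab"
  shows "shear \<phi> p = p"
  using assms \<rho>_outside by (auto simp: small_shift_def shear_def)

lemma slide_outside_slab:
  assumes "small_shift e \<phi>" "x \<in> topspace X - \<psi> ` slab"
  shows "slide \<phi> x = x"
proof (cases "x \<in> U")
  case True
  then obtain p where p: "p \<in> topspace strip" "x = \<psi> p" using image_chart by blast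
  then have "shear \<phi> p = p"
    using assms by (intro shear_outside_slab) auto
  then show ?thesis using p slide_chart[of p \<phi>] by simp
qed (use assms slide_outside in auto)

lemma continuous_shear:
  assumes "continuous_on UNIV \<phi>"
  shows "continuous_map strip strip (shear \<phi>)"
proof -
  have \<phi>: "continuous_map euclideanreal euclideanreal \<phi>"
    using assms by simp
  have "continuous_map strip euclideanreal (\<lambda>p. fst p + \<rho> (snd p) * (\<phi> (fst p) - fst p))"
    using continuous_map_compose[OF continuous_map_fst \<phi>, unfolded o_def]
      continuous_map_compose[OF continuous_map_snd continuous_\<rho>, unfolded o_def]
    by (intro continuous_map_add continuous_map_real_mult continuous_map_diff continuous_map_fst)
      auto
  moreover have "shear \<phi> = (\<lambda>p. (fst p + \<rho> (snd p) * (\<phi> (fst p) - fst p), snd p))"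
    by (auto simp: shear_def)
  ultimately show ?thesis
    by (simp add: continuous_map_paired continuous_map_snd)
qed

text \<open>On each line the map is the convex combination \<open>(1 - \<rho> y) t + \<rho> y \<phi> t\<close> of two strictly increasing
maps. It is injective for that reason, and onto by the intermediate value theorem, because far out
it is the identity.\<close>

lemma bij_shear:
  assumes \<phi>: "small_shift e \<phi>"
  shows "bij_betw (shear \<phi>) (topspace strip) (topspace strip)"
proof -
  have line: "bij (\<lambda>t. t + \<rho> y * (\<phi> t - t))" if y: "y \<in> topspace Y" for y
  proof -
    let ?f = "\<lambda>t. t + \<rho> y * (\<phi> t - t)"
    have r: "0 \<le> \<rho> y" "\<rho> y \<le> 1" using \<rho>_range[OF y] by auto
    have mono: "?f s < ?f t" if st: "s < t" for s t
    proof -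
      have lt: "\<phi> s < \<phi> t" using \<phi> st by (auto simp: small_shift_def strict_mono_def)
      have "?f t - ?f s = (1 - \<rho> y) * (t - s) + \<rho> y * (\<phi> t - \<phi> s)"
        by (simp add: algebra_simps)
      moreover have "\<dots> > 0"
      proof (cases "\<rho> y = 0")
        case False
        then have "\<rho> y * (\<phi> t - \<phi> s) > 0" "(1 - \<rho> y) * (t - s) \<ge> 0" using r st lt by auto
        then show ?thesis by linarith
      qed (use st in auto)
      ultimately show ?thesis by linarith
    qed
    have "inj ?f"
      using mono by (intro injI) (metis less_irrefl linorder_neqE)
    moreover have "\<exists>t. u = ?f t" for u
    proof -
      have fix_outside: "?f t = t" if "t \<notin> {-1..2}" for t
        using \<phi> that by (auto simp: small_shift_def)
      have cont: "continuous_on {min u (-2)..max u 3} ?f"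
        using \<phi> by (auto simp: small_shift_def intro!: continuous_intros intro: continuous_on_subset)
      have "?f (min u (-2)) = min u (-2)" "?f (max u 3) = max u 3"
        by (rule fix_outside; simp)+
      then have "?f (min u (-2)) \<le> u" "u \<le> ?f (max u 3)" "min u (-2) \<le> max u 3"
        by linarith+
      from IVT'[of ?f "min u (-2)" u "max u 3", OF this cont] show ?thesis
        by (elim exE conjE) (rule exI, erule sym)
    qed
    ultimately show ?thesis
      unfolding bij_def surj_def by blast
  qed
  show ?thesis
  proof (rule bij_betw_imageI)
    show "inj_on (shear \<phi>) (topspace strip)"
    proof (rule inj_onI)
      fix p p' assume p: "p \<in> topspace strip" and eq: "shear \<phi> p = shear \<phi> p'"
      obtain s t y where st: "p = (s, y)" "p' = (t, y)"
        using eq by (cases p, cases p') (auto simp: shear_def)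
      have "y \<in> topspace Y" "s + \<rho> y * (\<phi> s - s) = t + \<rho> y * (\<phi> t - t)"
        using p eq by (auto simp: shear_def st)
      then show "p = p'"
        using injD[OF bij_is_inj[OF line]] st by blast
    qed
    show "shear \<phi> ` topspace strip = topspace strip"
    proof
      show "topspace strip \<subseteq> shear \<phi> ` topspace strip"
      proof clarsimp
        fix u y assume y: "y \<in> topspace Y"
        obtain t where "u = t + \<rho> y * (\<phi> t - t)"
          using surjD[OF bij_is_surj[OF line[OF y]], of u] by blast
        then show "(u, y) \<in> shear \<phi> ` (UNIV \<times> topspace Y)"
          using y by (auto simp: shear_def image_iff)
      qed
    qed (auto simp: shear_def)
  qed
qed

text \<open>The two descriptions of \<open>slide \<phi>\<close>, through the chart on \<open>U\<close> and as the identity off the closed image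
of the slab, have open domains that cover the space.\<close>

lemma continuous_slide:
  assumes \<phi>: "small_shift e \<phi>"
  shows "continuous_map X X (slide \<phi>)"
  unfolding continuous_map_def
proof (intro conjI allI impI)
  show "slide \<phi> \<in> topspace X \<rightarrow> topspace X"
  proof
    fix x assume x: "x \<in> topspace X"
    show "slide \<phi> x \<in> topspace X"
    proof (cases "x \<in> U")
      case True
      then obtain p where p: "p \<in> topspace strip" "x = \<psi> p" using image_chart by blast
      then show ?thesis
        using chart_in_U[OF shear_in_strip[OF p(1)], of \<phi>] U_subset slide_chart[OF p(1), of \<phi>]
        by auto
    qed (use x slide_outside in auto)
  qed
  fix O' assume O': "openin X O'"
  have "continuous_map strip X (\<psi> \<circ> shear \<phi>)"
    using \<phi> by (intro continuous_map_compose[OF continuous_shear continuous_chart])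
      (simp add: small_shift_def)
  then have "openin strip {p \<in> topspace strip. \<psi> (shear \<phi> p) \<in> O'}"
    using openin_continuous_map_preimage O' by fastforce
  then have "openin X (\<psi> ` {p \<in> topspace strip. \<psi> (shear \<phi> p) \<in> O'} \<union> (O' - \<psi> ` slab))"
    by (intro openin_Un open_chart openin_diff O' closed_slab_image)
  moreover have "{x \<in> topspace X. slide \<phi> x \<in> O'}
      = \<psi> ` {p \<in> topspace strip. \<psi> (shear \<phi> p) \<in> O'} \<union> (O' - \<psi> ` slab)"
    (is "?A = ?B")
  proof
    show "?A \<subseteq> ?B"
    proof
      fix x assume x: "x \<in> ?A"
      show "x \<in> ?B"
      proof (cases "x \<in> U")
        case True
        then obtain p where p: "p \<in> topspace strip" "x = \<psi> p" using image_chart by blast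
        then have "\<psi> (shear \<phi> p) \<in> O'" using x slide_chart by auto
        then show ?thesis using p by blast
      next
        case False
        then have "x \<notin> \<psi> ` slab" using slab_subset chart_in_U by blast
        then show ?thesis using x False slide_outside by auto
      qed
    qed
    show "?B \<subseteq> ?A"
    proof
      fix x assume "x \<in> ?B"
      then show "x \<in> ?A"
      proof
        assume "x \<in> \<psi> ` {p \<in> topspace strip. \<psi> (shear \<phi> p) \<in> O'}"
        then show ?thesis using slide_chart chart_in_U U_subset by fastforce
      next
        assume "x \<in> O' - \<psi> ` slab"
        then show ?thesis
          using slide_outside_slab[OF \<phi>, of x] openin_subset[OF O'] by auto
      qed
    qed
  qed
  ultimately show "openin X {x \<in> topspace X. slide \<phi> x \<in> O'}" by simp
qed

text \<open>Only bijectivity has to be checked, separately on \<open>U\<close> and off \<open>U\<close>: a continuous bijection of a compact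
Hausdorff space onto itself is a homeomorphism.\<close>

lemma slide_in_Homeo:
  assumes \<phi>: "small_shift e \<phi>"
  shows "slide \<phi> \<in> Homeo X"
proof -
  have UU: "bij_betw (slide \<phi>) U U"
  proof -
    have \<psi>: "bij_betw \<psi> (topspace strip) U"
      using inj_chart image_chart by (simp add: bij_betw_def)
    have "bij_betw (\<psi> \<circ> shear \<phi>) (topspace strip) U"
      using bij_shear[OF \<phi>] \<psi> by (rule bij_betw_trans)
    moreover have "bij_betw (\<psi> \<circ> shear \<phi>) (topspace strip) U
        \<longleftrightarrow> bij_betw (slide \<phi> \<circ> \<psi>) (topspace strip) U"
      by (rule bij_betw_cong) (simp only: o_apply slide_chart)
    ultimately show ?thesis
      using bij_betw_comp_iff[OF \<psi>, of "slide \<phi>" U] by simp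
  qed
  moreover have "bij_betw (slide \<phi>) (topspace X - U) (topspace X - U)"
    using bij_betw_id[of "topspace X - U"]
    by (subst bij_betw_cong[of _ _ id]) (auto simp: slide_outside)
  ultimately have "bij_betw (slide \<phi>) (U \<union> (topspace X - U)) (U \<union> (topspace X - U))"
    by (rule bij_betw_combine) auto
  then have "bij_betw (slide \<phi>) (topspace X) (topspace X)"
    using U_subset by (simp add: Un_absorb1)
  then have "homeomorphic_map X X (slide \<phi>)"
    using continuous_slide[OF \<phi>] compact_X Hausdorff_X
    by (intro continuous_imp_homeomorphic_map) (auto simp: bij_betw_def)
  then show ?thesis
    by (simp add: Homeo_def slide_def)
qed

text \<open>The part of \<open>K\<close> in the slab is compact, and translating it by \<open>0\<close> along the lines keeps it inside the
open set \<open>O'\<close>. By Wallace's tube theorem the same is true of all translations by small amounts, which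
may differ from point to point.\<close>

lemma slide_near_id_compact_open:
  assumes K: "compactin X K" and O': "openin X O'" and KO: "K \<subseteq> O'"
  obtains e where "e > 0" "\<And>\<phi>. small_shift e \<phi> \<Longrightarrow> slide \<phi> ` K \<subseteq> O'"
proof -
  define B where "B = {p \<in> slab. \<psi> p \<in> K}"
  have "closedin strip {p \<in> topspace strip. \<psi> p \<in> K}"
    by (intro closedin_continuous_map_preimage[OF continuous_chart]
        compactin_imp_closedin Hausdorff_X K)
  with compact_slab have "compactin strip (slab \<inter> {p \<in> topspace strip. \<psi> p \<in> K})"
    by (rule compact_Int_closedin)
  moreover have "slab \<inter> {p \<in> topspace strip. \<psi> p \<in> K} = B"
    using slab_subset by (auto simp: B_def)
  ultimately have B: "compactin strip B" by simp
  let ?m = "\<lambda>(d::real, t::real, y::'b). (t + d, y)"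
  have m: "continuous_map (prod_topology euclideanreal strip) strip ?m"
  proof -
    have "continuous_map (prod_topology euclideanreal strip) euclideanreal
        (\<lambda>p. fst (snd p) + fst p)"
      by (intro continuous_map_add continuous_map_fst
          continuous_map_compose[OF continuous_map_snd continuous_map_fst, unfolded o_def])
    moreover have "continuous_map (prod_topology euclideanreal strip) Y (\<lambda>p. snd (snd p))"
      using continuous_map_compose[OF continuous_map_snd continuous_map_snd] by (simp add: o_def)
    moreover have "?m = (\<lambda>p. (fst (snd p) + fst p, snd (snd p)))" by auto
    ultimately show ?thesis by (simp add: continuous_map_paired)
  qed
  define W where "W = {p \<in> topspace (prod_topology euclideanreal strip). \<psi> (?m p) \<in> O'}"
  have "openin (prod_topology euclideanreal strip) W"
    using openin_continuous_map_preimage[OF continuous_map_compose[OF m continuous_chart] O']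
    by (simp add: W_def)
  moreover have "{0} \<times> B \<subseteq> W"
    using slab_subset KO by (auto simp: W_def B_def)
  moreover have "compactin euclideanreal {0}" by simp
  ultimately obtain D V where DV: "openin euclideanreal D" "{0} \<subseteq> D" "B \<subseteq> V" "D \<times> V \<subseteq> W"
    using Wallace_theorem_prod_topology[OF _ B] by metis
  then obtain e where e: "e > 0" "\<And>d. \<bar>d\<bar> < e \<Longrightarrow> d \<in> D"
    using open_contains_ball_eq[of D] by (force simp: dist_real_def)
  have "slide \<phi> x \<in> O'" if \<phi>: "small_shift e \<phi>" and x: "x \<in> K" for \<phi> x
  proof (cases "x \<in> \<psi> ` slab")
    case False
    then have "slide \<phi> x = x"
      using x compactin_subset_topspace[OF K] by (intro slide_outside_slab[OF \<phi>]) auto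
    then show ?thesis using x KO by auto
  next
    case True
    then obtain t y where p: "(t, y) \<in> slab" "x = \<psi> (t, y)" by auto
    then have ty: "(t, y) \<in> topspace strip" using slab_subset by blast
    have "\<bar>\<rho> y * (\<phi> t - t)\<bar> \<le> 1 * \<bar>\<phi> t - t\<bar>"
      using \<rho>_range[of y] ty unfolding abs_mult by (intro mult_right_mono) auto
    also have "\<dots> < e" using \<phi> by (simp add: small_shift_def)
    finally have "(\<rho> y * (\<phi> t - t), t, y) \<in> D \<times> V"
      using e DV(3) p x by (auto simp: B_def)
    then have "\<psi> (t + \<rho> y * (\<phi> t - t), y) \<in> O'" using DV(4) by (auto simp: W_def)
    then show ?thesis using slide_chart[OF ty, of \<phi>] p by (simp add: shear_def)
  qed
  then show ?thesis using e(1) that by blast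
qed

text \<open>The preceding lemma is the case of a subbasic neighbourhood of the identity; the property passes to
finite intersections and arbitrary unions.\<close>

lemma slide_near_id:
  assumes V: "openin (Homeo_topology X) V" and id: "(\<lambda>x\<in>topspace X. x) \<in> V"
  obtains e where "e > 0" "\<And>\<phi>. small_shift e \<phi> \<Longrightarrow> slide \<phi> \<in> V"
proof -
  obtain S where S: "openin (compact_open_topology X X) S" "V = S \<inter> Homeo X"
    using V by (auto simp: Homeo_topology_def openin_subtopology)
  have "generate_topology_on
    {{f \<in> continuous_functions X X. f ` K \<subseteq> O'} | K O'. compactin X K \<and> openin X O'} S"
    using S(1) by (simp add: compact_open_topology_def openin_topology_generated_by_iff)
  then have "(\<lambda>x\<in>topspace X. x) \<in> S \<longrightarrow> (\<exists>e>0. \<forall>\<phi>. small_shift e \<phi> \<longrightarrow> slide \<phi> \<in> S)"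
  proof induction
    case (Int a b)
    show ?case
    proof
      assume "(\<lambda>x\<in>topspace X. x) \<in> a \<inter> b"
      then obtain e1 e2 where "e1 > 0" "\<And>\<phi>. small_shift e1 \<phi> \<Longrightarrow> slide \<phi> \<in> a"
        "e2 > 0" "\<And>\<phi>. small_shift e2 \<phi> \<Longrightarrow> slide \<phi> \<in> b"
        using Int.IH by blast
      then show "\<exists>e>0. \<forall>\<phi>. small_shift e \<phi> \<longrightarrow> slide \<phi> \<in> a \<inter> b"
        by (intro exI[of _ "min e1 e2"]) (auto simp: small_shift_def)
    qed
  next
    case (Basis s)
    then obtain K O' where s: "compactin X K" "openin X O'"
      "s = {f \<in> continuous_functions X X. f ` K \<subseteq> O'}" by blast
    show ?case
    proof
      assume "(\<lambda>x\<in>topspace X. x) \<in> s"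
      then have "K \<subseteq> O'" using s compactin_subset_topspace[OF s(1)] by auto
      then obtain e where "e > 0" "\<And>\<phi>. small_shift e \<phi> \<Longrightarrow> slide \<phi> ` K \<subseteq> O'"
        using slide_near_id_compact_open s by blast
      then show "\<exists>e>0. \<forall>\<phi>. small_shift e \<phi> \<longrightarrow> slide \<phi> \<in> s"
        using slide_in_Homeo Homeo_subset_continuous_functions s(3) by blast
    qed
  qed blast+
  then show ?thesis
    using id S(2) slide_in_Homeo that by blast
qed

definition point :: "real \<Rightarrow> 'a"
  where "point t = \<psi> (t, y\<^sub>0)"

lemma point_in_strip: "(t, y\<^sub>0) \<in> topspace strip"
  using y\<^sub>0 by simp

lemma point_in_X: "point t \<in> topspace X"
  using chart_in_U[OF point_in_strip] U_subset by (auto simp: point_def)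

lemma point_eq_iff: "point s = point t \<longleftrightarrow> s = t"
  using chart_eq_iff[OF point_in_strip point_in_strip] by (simp add: point_def)

lemma slide_point: "slide \<phi> (point t) = point (\<phi> t)"
  using slide_chart[OF point_in_strip] by (simp add: point_def shear_def \<rho>_y\<^sub>0)

end

section \<open>Powers of one element in the direct sum\<close>

text \<open>The formal integer combination \<open>k\<close> of points, read as an element of the direct sum by replacing the
multiples of a point \<open>x\<close> with powers of \<open>h\<close> in the copy of the group at \<open>x\<close>. Powers of one element
commute, so this is a homomorphism even if the group is not commutative, and computations in the
direct sum turn into sums of integers.\<close>

definition powers :: "('h, 'm) monoid_scheme \<Rightarrow> 'a topology \<Rightarrow> 'h \<Rightarrow> ('a \<Rightarrow> int) \<Rightarrow> 'a \<Rightarrow> 'h"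
  where "powers H X h k = (\<lambda>x\<in>topspace X. h [^]\<^bsub>H\<^esub> k x)"

lemma group_copies_sum: "group H \<Longrightarrow> group (copies_sum H X)"
  by (simp add: copies_sum_def)

lemma powers_zero: "powers H X h (\<lambda>x. 0) = \<one>\<^bsub>copies_sum H X\<^esub>"
  by (simp add: powers_def copies_sum_def)

lemma powers_in_carrier:
  assumes "group H" "h \<in> carrier H" "finite {x. k x \<noteq> 0}"
  shows "powers H X h k \<in> carrier (copies_sum H X)"
proof -
  have "{x \<in> topspace X. powers H X h k x \<noteq> \<one>\<^bsub>H\<^esub>} \<subseteq> {x. k x \<noteq> 0}"
    by (auto simp: powers_def)
  then have "finite {x \<in> topspace X. powers H X h k x \<noteq> \<one>\<^bsub>H\<^esub>}"
    using assms(3) by (rule finite_subset)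
  moreover have "powers H X h k \<in> (\<Pi>\<^sub>E x\<in>topspace X. carrier H)"
    using assms by (auto simp: powers_def group.int_pow_closed)
  ultimately show ?thesis
    using assms(1) by (simp add: copies_sum_def carrier_sum_group)
qed

lemma powers_add:
  assumes "group H" "h \<in> carrier H"
  shows "powers H X h k \<otimes>\<^bsub>copies_sum H X\<^esub> powers H X h k' = powers H X h (\<lambda>x. k x + k' x)"
  using assms by (auto simp: powers_def copies_sum_def group.int_pow_mult)

lemma powers_diff:
  assumes "group H" "h \<in> carrier H" "finite {x. k x \<noteq> 0}" "finite {x. k' x \<noteq> 0}"
  shows "powers H X h k \<otimes>\<^bsub>copies_sum H X\<^esub> inv\<^bsub>copies_sum H X\<^esub> powers H X h k'
    = powers H X h (\<lambda>x. k x - k' x)"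
proof -
  interpret G: group "copies_sum H X" using assms(1) by (rule group_copies_sum)
  have "finite {x. k x - k' x \<noteq> 0}"
    using assms(3,4) by (rule rev_finite_subset[OF finite_UnI]) auto
  then have "powers H X h (\<lambda>x. k x - k' x) \<in> carrier (copies_sum H X)"
    by (rule powers_in_carrier[OF assms(1,2)])
  moreover have "powers H X h k = powers H X h (\<lambda>x. k x - k' x) \<otimes>\<^bsub>copies_sum H X\<^esub> powers H X h k'"
    using powers_add[OF assms(1,2), of X "\<lambda>x. k x - k' x" k'] by simp
  ultimately show ?thesis
    using powers_in_carrier[OF assms(1,2,3)] powers_in_carrier[OF assms(1,2,4)]
    by (simp add: G.m_assoc)
qed

lemma translate_powers:
  assumes "g \<in> Homeo X" "\<And>x. x \<in> topspace X \<Longrightarrow> k' (g x) = k x"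
  shows "translate X g (powers H X h k) = powers H X h k'"
proof
  fix y
  show "translate X g (powers H X h k) y = powers H X h k' y"
  proof (cases "y \<in> topspace X")
    case True
    then obtain x where "x \<in> topspace X" "y = g x"
      using Homeo_imp_Bij[OF assms(1)] by (auto simp: Bij_def bij_betw_def)
    then show ?thesis
      using True assms by (simp add: translate_apply) (simp add: powers_def)
  qed (simp add: translate_def powers_def)
qed

lemma translate_identity:
  assumes "group H" "u \<in> carrier (copies_sum H X)"
  shows "translate X (\<lambda>x\<in>topspace X. x) u = u"
proof
  fix y
  have u: "u \<in> extensional (topspace X)"
    using assms by (simp add: copies_sum_def carrier_sum_group PiE_def)
  have "inv_into (topspace X) (\<lambda>x\<in>topspace X. x) y = y" if "y \<in> topspace X"
    using that by (intro inv_into_f_eq) (auto simp: inj_on_def)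
  then show "translate X (\<lambda>x\<in>topspace X. x) u y = u y"
    using u by (auto simp: translate_def extensional_def)
qed

section \<open>Alternating sums along an arc\<close>

lemma openin_prod_topology_boxE:
  assumes "openin (prod_topology A B) Q" "(a, b) \<in> Q"
  obtains V W where "openin A V" "a \<in> V" "openin B W" "b \<in> W" "V \<times> W \<subseteq> Q"
  using assms unfolding openin_prod_topology_alt by blast

text \<open>The topology \<open>T\<close> is to be shown non-Hausdorff as soon as \<open>h\<close> is not the identity; the elements that
witness this have powers of \<open>h\<close> as entries.\<close>

locale continuous_action = flow_box X Y U \<psi> \<rho> L y\<^sub>0
  for X :: "'a topology" and Y :: "'b topology" and U \<psi> \<rho> L y\<^sub>0 +
  fixes H :: "('h, 'm) monoid_scheme" and h :: 'h and T :: "('a \<Rightarrow> 'h) topology"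
  assumes group_H: "group H" and h: "h \<in> carrier H"
    and group_T: "group_topology (copies_sum H X) T"
    and action: "continuous_map (prod_topology (Homeo_topology X) T) T (\<lambda>(g, u). translate X g u)"
begin

abbreviation "G \<equiv> copies_sum H X"
abbreviation "E \<equiv> powers H X h"

sublocale G: group G
  using group_H by (rule group_copies_sum)

lemma topspace_T: "topspace T = carrier G"
  using group_T by (simp add: group_topology_def)

lemma E_in_T: "finite {x. k x \<noteq> 0} \<Longrightarrow> E k \<in> topspace T"
  by (simp add: topspace_T powers_in_carrier group_H h)

lemma action_nhd:
  assumes W: "openin T W" and w: "w \<in> W"
  obtains e W' where "e > 0" "openin T W'" "w \<in> W'"
    "\<And>\<phi> u. small_shift e \<phi> \<Longrightarrow> u \<in> W' \<Longrightarrow> translate X (slide \<phi>) u \<in> W"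
proof -
  let ?id = "\<lambda>x\<in>topspace X. x"
  let ?P = "prod_topology (Homeo_topology X) T"
  have id: "?id \<in> Homeo X"
    using homeomorphic_map_eq[of X X id ?id] by (simp add: Homeo_def)
  have wT: "w \<in> topspace T" using W w openin_subset by blast
  let ?Q = "{p \<in> topspace ?P. (\<lambda>(g, u). translate X g u) p \<in> W}"
  have "openin ?P ?Q"
    using action W by (rule openin_continuous_map_preimage)
  moreover have "(?id, w) \<in> ?Q"
    using id w wT translate_identity[OF group_H, of w X]
    by (simp add: topspace_Homeo_topology topspace_T)
  ultimately obtain V W' where V: "openin (Homeo_topology X) V" "?id \<in> V"
    and W': "openin T W'" "w \<in> W'" and VW: "V \<times> W' \<subseteq> ?Q"
    by (rule openin_prod_topology_boxE)
  obtain e where e: "e > 0" "\<And>\<phi>. small_shift e \<phi> \<Longrightarrow> slide \<phi> \<in> V"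
    using slide_near_id[OF V] by blast
  show ?thesis
  proof (rule that[OF e(1) W'])
    fix \<phi> u assume "small_shift e \<phi>" "u \<in> W'"
    then have "(slide \<phi>, u) \<in> ?Q"
      using e(2) by (intro subsetD[OF VW]) simp
    then show "translate X (slide \<phi>) u \<in> W" by simp
  qed
qed

text \<open>Opposite unit charges, so that \<open>E (dipole s t)\<close> is the difference \<open>h\<^sub>s - h\<^sub>t\<close> of two copies of \<open>h\<close>.\<close>

definition dipole :: "real \<Rightarrow> real \<Rightarrow> 'a \<Rightarrow> int"
  where "dipole s t x = of_bool (x = point s) - of_bool (x = point t)"

lemma finite_dipole: "finite {x. dipole s t x \<noteq> 0}"
  by (rule finite_subset[of _ "{point s, point t}"]) (auto simp: dipole_def)

lemma finite_dipoles: "finite {x. (\<Sum>i<m. dipole (l i) (q i) x) \<noteq> 0}" for m :: nat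
proof (rule finite_subset)
  show "{x. (\<Sum>i<m. dipole (l i) (q i) x) \<noteq> 0} \<subseteq> (\<Union>i<m. {x. dipole (l i) (q i) x \<noteq> 0})"
    by (auto elim: sum.not_neutral_contains_not_neutral)
qed (use finite_dipole in auto)

lemma slide_eq_point_iff:
  assumes "small_shift e \<phi>" "x \<in> topspace X"
  shows "slide \<phi> x = point (\<phi> t) \<longleftrightarrow> x = point t"
proof -
  have "inj_on (slide \<phi>) (topspace X)"
    using Homeo_imp_Bij[OF slide_in_Homeo[OF assms(1)]] by (simp add: Bij_def bij_betw_def)
  then show ?thesis
    using assms(2) point_in_X slide_point by (metis inj_on_eq_iff)
qed

text \<open>Continuity of the action at the element \<open>h\<close> placed at \<open>point l\<close> says that this element changes little
when \<open>point l\<close> is moved to \<open>point q\<close> with \<open>q\<close> close to \<open>l\<close>. Once \<open>q\<close> is close enough,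
the difference of the two can thus be added to a given element of an open set without leaving it.\<close>

lemma short_dipole:
  assumes W: "openin T W" and k: "finite {x. k x \<noteq> 0}" "E k \<in> W"
    and l: "0 \<le> l" "l \<le> 1" and d: "0 < d"
  obtains q where "l < q" "q \<le> l + d" "E (\<lambda>x. k x + dipole l q x) \<in> W"
proof -
  define \<delta> where "\<delta> t x = (of_bool (x = point t) :: int)" for t x
  have \<delta>: "finite {x. \<delta> t x \<noteq> 0}" for t
    by (rule finite_subset[of _ "{point t}"]) (auto simp: \<delta>_def)
  let ?k = "\<lambda>x. k x + \<delta> l x"
  have k': "finite {x. ?k x \<noteq> 0}"
    using k(1) \<delta>[of l] by (rule rev_finite_subset[OF finite_UnI]) auto
  \<comment> \<open>\<open>?F\<close> maps the single mass at \<open>point l\<close> to \<open>E k\<close>, and the one at \<open>point q\<close> to the desired sum.\<close>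
  let ?F = "\<lambda>w. E ?k \<otimes>\<^bsub>G\<^esub> inv\<^bsub>G\<^esub> w"
  have F: "?F (E (\<delta> t)) = E (\<lambda>x. k x + dipole l t x)" for t
  proof -
    have "(\<lambda>x. k x + dipole l t x) = (\<lambda>x. ?k x - \<delta> t x)"
      by (simp add: dipole_def \<delta>_def fun_eq_iff)
    then show ?thesis
      using powers_diff[OF group_H h k' \<delta>, of X t] by simp
  qed
  have "continuous_map T T ?F"
  proof -
    have "continuous_map T (prod_topology T T) (\<lambda>w. (E ?k, inv\<^bsub>G\<^esub> w))"
      using group_T E_in_T[OF k'] by (simp add: continuous_map_paired group_topology_def)
    from continuous_map_compose[OF this, of T "\<lambda>(u, v). u \<otimes>\<^bsub>G\<^esub> v"] show ?thesis
      using group_T by (simp add: group_topology_def o_def)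
  qed
  then have "openin T {w \<in> topspace T. ?F w \<in> W}"
    using W by (rule openin_continuous_map_preimage)
  moreover have "E (\<delta> l) \<in> {w \<in> topspace T. ?F w \<in> W}"
    using k E_in_T[OF \<delta>] by (simp add: F) (simp add: dipole_def)
  ultimately obtain e W' where e: "e > 0" "E (\<delta> l) \<in> W'"
    "\<And>\<phi> u. small_shift e \<phi> \<Longrightarrow> u \<in> W' \<Longrightarrow>
      translate X (slide \<phi>) u \<in> {w \<in> topspace T. ?F w \<in> W}"
    by (rule action_nhd) blast
  \<comment> \<open>The stretch takes place in \<open>[l - \<eta>, l + 2 \<eta>]\<close>, which has to stay in the window \<open>[-1, 2]\<close>.\<close>
  define \<eta> where "\<eta> = min (e / 4) (min d (1 / 2))"
  have \<eta>: "0 < \<eta>" "3 * \<eta> < e" "\<eta> \<le> d" "\<eta> \<le> 1 / 2"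
    using e(1) d by (auto simp: \<eta>_def)
  define \<phi> where "\<phi> = stretch (l - \<eta>) l (l + \<eta>) (l + 2 * \<eta>)"
  have \<phi>: "small_shift e \<phi>" "\<phi> l = l + \<eta>"
    unfolding \<phi>_def using \<eta> l by (intro small_shift_stretch stretch_bounds; simp)+
  have "translate X (slide \<phi>) (E (\<delta> l)) = E (\<delta> (l + \<eta>))"
    using slide_in_Homeo[OF \<phi>(1)] slide_eq_point_iff[OF \<phi>(1), of _ l] \<phi>(2)
    by (intro translate_powers) (auto simp: \<delta>_def)
  then have "E (\<lambda>x. k x + dipole l (l + \<eta>) x) \<in> W"
    using e(3)[OF \<phi>(1) e(2)] F by simp
  then show ?thesis
    using that[of "l + \<eta>"] \<eta> by simp
qed

lemma short_dipoles:
  fixes m :: nat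
  assumes W: "openin T W" "\<one>\<^bsub>G\<^esub> \<in> W" and d: "0 < d"
    and l: "\<And>i. i < m \<Longrightarrow> 0 \<le> l i \<and> l i \<le> 1"
  shows "\<exists>q. (\<forall>i<m. l i < q i \<and> q i \<le> l i + d) \<and> E (\<lambda>x. \<Sum>i<m. dipole (l i) (q i) x) \<in> W"
  using l
proof (induction m)
  case 0
  show ?case using W by (simp add: powers_zero)
next
  case (Suc m)
  then obtain q where q: "\<And>i. i < m \<Longrightarrow> l i < q i \<and> q i \<le> l i + d"
    "E (\<lambda>x. \<Sum>i<m. dipole (l i) (q i) x) \<in> W"
    by (meson less_Suc_eq)
  obtain r where r: "l m < r" "r \<le> l m + d"
    "E (\<lambda>x. (\<Sum>i<m. dipole (l i) (q i) x) + dipole (l m) r x) \<in> W"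
    using short_dipole[OF W(1) finite_dipoles q(2)] Suc.prems[of m] d by blast
  show ?case
    using q(1) r by (intro exI[of _ "q(m := r)"]) (auto simp: less_Suc_eq)
qed

text \<open>The heart of the proof: the dipoles need not be short, and their number does not matter, as long
as the mesh is below a bound depending on \<open>W\<close> only. Continuity of the action at the pair (identity,
zero) gives a neighbourhood \<open>W'\<close> of zero that all sufficiently small slides map into \<open>W\<close>. A
sum of very short dipoles, chosen inside \<open>W'\<close> for the prescribed number \<open>m\<close>, is then stretched by a
single small slide to a sum of dipoles of length \<open>d\<close>.\<close>

lemma grid_dipoles:
  assumes W: "openin T W" "\<one>\<^bsub>G\<^esub> \<in> W"
  obtains e where "e > 0"
    "\<And>m d s. \<lbrakk>0 < d; 2 * d < e; 0 \<le> s; d \<le> 1; s + 2 * real m * d \<le> 1 + d\<rbrakk> \<Longrightarrow>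
      E (\<lambda>x. \<Sum>i<m. dipole (s + 2 * real i * d) (s + 2 * real i * d + d) x) \<in> W"
proof -
  obtain e W' where e: "e > 0" "openin T W'" "\<one>\<^bsub>G\<^esub> \<in> W'"
    "\<And>\<phi> u. small_shift e \<phi> \<Longrightarrow> u \<in> W' \<Longrightarrow> translate X (slide \<phi>) u \<in> W"
    using action_nhd[OF W] by metis
  have "E (\<lambda>x. \<Sum>i<m. dipole (s + 2 * real i * d) (s + 2 * real i * d + d) x) \<in> W"
    if d: "0 < d" "2 * d < e" "d \<le> 1" and s: "0 \<le> s" "s + 2 * real m * d \<le> 1 + d" for m :: nat and d s
  proof -
    have "0 \<le> s + 2 * real i * d \<and> s + 2 * real i * d \<le> 1" if "i < m" for i
    proof -
      have "real i + 1 \<le> real m" using that by linarith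
      from mult_right_mono[OF this, of d] d s show ?thesis by (auto simp: algebra_simps)
    qed
    then obtain q where q: "\<And>i. i < m \<Longrightarrow> s + 2 * real i * d < q i \<and> q i \<le> s + 2 * real i * d + d"
      "E (\<lambda>x. \<Sum>i<m. dipole (s + 2 * real i * d) (q i) x) \<in> W'"
      using short_dipoles[OF e(2,3) d(1), of m "\<lambda>i. s + 2 * real i * d"] by auto
    obtain \<phi> where \<phi>: "strict_mono \<phi>" "continuous_on UNIV \<phi>"
      "\<And>t. t \<le> \<phi> t \<and> \<phi> t \<le> t + 2 * d" "\<And>t. t \<notin> {s<..<s + 2 * real m * d} \<Longrightarrow> \<phi> t = t"
      "\<And>i. i < m \<Longrightarrow> \<phi> (s + 2 * real i * d) = s + 2 * real i * d"
      "\<And>i. i < m \<Longrightarrow> \<phi> (q i) = s + 2 * real i * d + d"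
      using simultaneous_stretch[OF d(1) q(1)] by blast
    have small: "small_shift e \<phi>"
      unfolding small_shift_def
    proof (intro conjI allI impI)
      fix t
      show "\<bar>\<phi> t - t\<bar> < e" using \<phi>(3)[of t] d by linarith
      show "\<phi> t = t" if "t \<notin> {-1..2}" using that s d by (intro \<phi>(4)) auto
    qed (use \<phi> in auto)
    have "translate X (slide \<phi>) (E (\<lambda>x. \<Sum>i<m. dipole (s + 2 * real i * d) (q i) x))
      = E (\<lambda>x. \<Sum>i<m. dipole (s + 2 * real i * d) (s + 2 * real i * d + d) x)"
    proof (rule translate_powers[OF slide_in_Homeo[OF small]], rule sum.cong[OF refl])
      fix x i assume x: "x \<in> topspace X" and "i \<in> {..<m}"
      then have i: "i < m" by simp
      show "dipole (s + 2 * real i * d) (s + 2 * real i * d + d) (slide \<phi> x) = dipole (s + 2 * real i * d) (q i) x"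
        using slide_eq_point_iff[OF small x, of "s + 2 * real i * d"]
          slide_eq_point_iff[OF small x, of "q i"] \<phi>(5,6)[OF i]
        by (simp add: dipole_def)
    qed
    then show ?thesis using e(4)[OF small q(2)] by simp
  qed
  then show ?thesis using that e(1) by blast
qed

text \<open>With \<open>2 m d = 1\<close>, the dipoles from even to odd grid points and those from odd to even grid points
are two sums to which \<open>grid_dipoles\<close> applies. Added up, they telescope to the dipole from \<open>0\<close> to
\<open>1\<close>, which does not depend on the neighbourhood \<open>N\<close>.\<close>

lemma long_dipole:
  assumes N: "openin T N" "\<one>\<^bsub>G\<^esub> \<in> N"
  shows "E (dipole 0 1) \<in> N"
proof -
  let ?Q = "{p \<in> topspace (prod_topology T T). (\<lambda>(u, v). u \<otimes>\<^bsub>G\<^esub> v) p \<in> N}"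
  have "openin (prod_topology T T) ?Q"
    using group_T N by (intro openin_continuous_map_preimage) (auto simp: group_topology_def)
  moreover have "(\<one>\<^bsub>G\<^esub>, \<one>\<^bsub>G\<^esub>) \<in> ?Q"
    using N by (simp add: topspace_T)
  ultimately obtain W1 W2 where W12: "openin T W1" "\<one>\<^bsub>G\<^esub> \<in> W1" "openin T W2" "\<one>\<^bsub>G\<^esub> \<in> W2"
    "W1 \<times> W2 \<subseteq> ?Q"
    by (rule openin_prod_topology_boxE)
  obtain e where e: "e > 0"
    "\<And>m d s. \<lbrakk>0 < d; 2 * d < e; 0 \<le> s; d \<le> 1; s + 2 * real m * d \<le> 1 + d\<rbrakk> \<Longrightarrow>
      E (\<lambda>x. \<Sum>i<m. dipole (s + 2 * real i * d) (s + 2 * real i * d + d) x) \<in> W1 \<inter> W2"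
    using grid_dipoles[OF openin_Int[OF W12(1,3)] IntI[OF W12(2,4)]] by blast
  obtain m :: nat where m: "1 / e < m" "m > 0"
    using reals_Archimedean2[of "1 / e"] e(1)
    by (metis divide_pos_pos less_trans of_nat_0_less_iff zero_less_one)
  define d where "d = 1 / (2 * real m)"
  have d: "0 < d" "2 * d < e" "d \<le> 1" "2 * real m * d = 1"
    using m e(1) by (auto simp: d_def field_simps)
  let ?a = "\<lambda>x. \<Sum>i<m. dipole (0 + 2 * real i * d) (0 + 2 * real i * d + d) x"
  let ?b = "\<lambda>x. \<Sum>i<m. dipole (d + 2 * real i * d) (d + 2 * real i * d + d) x"
  have "E ?a \<in> W1" "E ?b \<in> W2"
    using e(2)[of d 0 m] e(2)[of d d m] d by auto
  then have "(E ?a, E ?b) \<in> ?Q"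
    by (intro subsetD[OF W12(5)] SigmaI)
  then have "E ?a \<otimes>\<^bsub>G\<^esub> E ?b \<in> N"
    by simp
  moreover have "?a x + ?b x = dipole 0 1 x" for x
  proof -
    define f where "f i = (of_bool (x = point (2 * real i * d)) :: int)" for i
    have "?a x + ?b x = (\<Sum>i<m. f i - f (Suc i))"
      unfolding sum.distrib[symmetric]
      by (rule sum.cong) (auto simp: dipole_def f_def algebra_simps)
    also have "\<dots> = f 0 - f m" by (rule sum_lessThan_telescope')
    finally show ?thesis using d(4) by (simp add: f_def dipole_def)
  qed
  ultimately show ?thesis
    by (simp add: powers_add[OF group_H h])
qed

lemma not_Hausdorff:
  assumes "h \<noteq> \<one>\<^bsub>H\<^esub>"
  shows "\<not> Hausdorff_space T"
proof
  assume "Hausdorff_space T"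
  moreover have "E (dipole 0 1) \<noteq> \<one>\<^bsub>G\<^esub>"
  proof
    assume "E (dipole 0 1) = \<one>\<^bsub>G\<^esub>"
    then have "E (dipole 0 1) (point 0) = \<one>\<^bsub>H\<^esub>"
      using point_in_X by (simp add: copies_sum_def)
    then show False
      using assms point_in_X h group_H
      by (simp add: powers_def dipole_def point_eq_iff group.int_pow_1)
  qed
  ultimately obtain N where "openin T N" "\<one>\<^bsub>G\<^esub> \<in> N" "E (dipole 0 1) \<notin> N"
    using E_in_T[OF finite_dipole, of 0 1] G.one_closed
    unfolding Hausdorff_space_def topspace_T by (metis disjnt_iff)
  then show False using long_dipole by blast
qed

end

section \<open>Flow boxes in spaces that contain an open cube\<close>

lemma homeomorphic_space_product_split:
  assumes i: "i \<in> I"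
  shows "product_topology X I homeomorphic_space prod_topology (X i) (product_topology X (I - {i}))"
proof -
  let ?P = "product_topology X I" and ?Q = "product_topology X (I - {i})"
  let ?f = "\<lambda>x. (x i, restrict x (I - {i}))"
  let ?g = "\<lambda>p. \<lambda>j\<in>I. if j = i then fst p else snd p j"
  have f: "continuous_map ?P (prod_topology (X i) ?Q) ?f"
  proof -
    have "continuous_map ?P ?Q (\<lambda>x. restrict x (I - {i}))"
      unfolding continuous_map_componentwise
      by (auto intro!: continuous_map_eq[OF continuous_map_product_projection])
    then show ?thesis
      using i by (simp add: continuous_map_paired continuous_map_product_projection)
  qed
  have g: "continuous_map (prod_topology (X i) ?Q) ?P ?g"
    unfolding continuous_map_componentwise
  proof (intro conjI ballI)
    fix k assume k: "k \<in> I"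
    show "continuous_map (prod_topology (X i) ?Q) (X k) (\<lambda>p. ?g p k)"
    proof (cases "k = i")
      case True
      then show ?thesis using k by (simp add: continuous_map_fst)
    next
      case False
      then have "k \<in> I - {i}" using k by simp
      from continuous_map_compose[OF continuous_map_snd continuous_map_product_projection[OF this]]
      show ?thesis using k False by (simp add: o_def)
    qed
  qed auto
  have "?g (?f x) = x" if "x \<in> topspace ?P" for x
    using that i by (auto simp: fun_eq_iff PiE_iff extensional_def)
  moreover have "?f (?g p) = p" if "p \<in> topspace (prod_topology (X i) ?Q)" for p
  proof (rule prod_eqI)
    have "snd p \<in> extensional (I - {i})"
      using that by (simp add: PiE_def mem_Times_iff)
    then show "snd (?f (?g p)) = snd p"
      by (intro ext) (simp add: restrict_def extensional_def)
  qed (use i in simp)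
  ultimately have "homeomorphic_maps ?P (prod_topology (X i) ?Q) ?f ?g"
    using f g unfolding homeomorphic_maps_def by blast
  then show ?thesis by (rule homeomorphic_maps_imp_homeomorphic_space)
qed

lemma homeomorphic_space_top_of_set:
  assumes "S homeomorphic T"
  shows "top_of_set S homeomorphic_space top_of_set T"
proof -
  obtain f g where fg: "homeomorphism S T f g"
    using assms unfolding homeomorphic_def by blast
  have "homeomorphic_maps (top_of_set S) (top_of_set T) f g"
    using fg unfolding homeomorphic_maps_def homeomorphism_def by (auto simp: image_subset_iff)
  then show ?thesis by (rule homeomorphic_maps_imp_homeomorphic_space)
qed

lemma open_unit_interval_homeomorphic_line:
  "top_of_set {0<..<1::real} homeomorphic_space euclideanreal"
proof -
  have "ball (1/2) (1/2) = {0<..<1::real}"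
    by (auto simp: ball_def dist_real_def abs_if split: if_splits)
  then show ?thesis
    using homeomorphic_space_top_of_set[OF homeomorphic_ball_UNIV[of "1/2" "1/2::real"]] by simp
qed

text \<open>This covers the infinite-dimensional cube as well; the transversal is the product of the remaining
factors.\<close>

lemma open_cube_homeomorphic_strip:
  assumes "n \<noteq> 0"
  obtains Y :: "(nat \<Rightarrow> real) topology"
  where "topspace Y \<noteq> {}" "open_cube n homeomorphic_space prod_topology euclideanreal Y"
proof -
  let ?I = "{i. enat i < n}"
  let ?Y = "product_topology (\<lambda>_. top_of_set {0<..<1::real}) (?I - {0})"
  have "0 \<in> ?I" using assms by (simp add: zero_enat_def[symmetric])
  then have "open_cube n homeomorphic_space prod_topology (top_of_set {0<..<1::real}) ?Y"
    using homeomorphic_space_product_split[of 0 ?I "\<lambda>_. top_of_set {0<..<1::real}"]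
    by (simp add: open_cube_def)
  also have "\<dots> homeomorphic_space prod_topology euclideanreal ?Y"
    by (intro homeomorphic_space_prod_topology open_unit_interval_homeomorphic_line
        homeomorphic_space_refl)
  finally have "open_cube n homeomorphic_space prod_topology euclideanreal ?Y" .
  moreover have "(\<lambda>i\<in>?I - {0}. 1 / 2) \<in> topspace ?Y"
    by (simp add: PiE_iff)
  ultimately show ?thesis using that by blast
qed

lemma locally_compact_bump:
  assumes Y: "locally_compact_space Y" "Hausdorff_space Y" and y: "y \<in> topspace Y"
  obtains \<rho> :: "'b \<Rightarrow> real" and L where
    "continuous_map Y euclideanreal \<rho>" "\<And>z. z \<in> topspace Y \<Longrightarrow> 0 \<le> \<rho> z \<and> \<rho> z \<le> 1"
    "\<rho> y = 1" "compactin Y L" "\<And>z. z \<in> topspace Y - L \<Longrightarrow> \<rho> z = 0"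
proof -
  obtain N L where N: "openin Y N" "compactin Y L" "y \<in> N" "N \<subseteq> L"
    using Y(1) y unfolding locally_compact_space_def by blast
  have "completely_regular_space Y"
    using Y by (simp add: locally_compact_regular_imp_completely_regular_space)
  moreover have "closedin Y (topspace Y - N)" "y \<in> topspace Y - (topspace Y - N)"
    using N y by auto
  ultimately obtain f :: "'b \<Rightarrow> real" where f: "continuous_map Y (top_of_set {0..1}) f"
    "f y = 0" "f ` (topspace Y - N) \<subseteq> {1}"
    unfolding completely_regular_space_def by blast
  have f': "continuous_map Y euclideanreal f" "\<And>z. z \<in> topspace Y \<Longrightarrow> f z \<in> {0..1}"
    using f(1) by (auto simp: continuous_map_in_subtopology Pi_iff)
  show ?thesis
  proof (rule that[of "\<lambda>z. 1 - f z" L])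
    show "continuous_map Y euclideanreal (\<lambda>z. 1 - f z)"
      using f'(1) by (intro continuous_intros)
    show "0 \<le> 1 - f z \<and> 1 - f z \<le> 1" if "z \<in> topspace Y" for z
      using f'(2)[OF that] by simp
    show "1 - f z = 0" if "z \<in> topspace Y - L" for z
      using f(3) N(4) that by (auto simp: image_subset_iff)
  qed (use f(2) N(2) in auto)
qed

text \<open>A space of the form line times \<open>Y\<close> that is homeomorphic to an open subset of a compact Hausdorff
  space is locally compact and Hausdorff, so its factor \<open>Y\<close> carries the cutoff functions that a flow
  box requires.\<close>

lemma no_Hausdorff_group_topology:
  assumes H: "group H" "\<not> trivial_group H"
    and X: "compact_space X" "Hausdorff_space X" and U: "openin X U"
    and strip: "subtopology X U homeomorphic_space prod_topology euclideanreal Y"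
    and Y: "topspace Y \<noteq> {}"
    and T: "group_topology (copies_sum H X) T"
      "continuous_map (prod_topology (Homeo_topology X) T) T (\<lambda>(g, u). translate X g u)"
  shows "\<not> Hausdorff_space T"
proof -
  obtain y where y: "y \<in> topspace Y"
    using Y by blast
  have nontrivial: "prod_topology euclideanreal Y \<noteq> trivial_topology"
    using y by (auto simp: prod_topology_trivial_iff)
  have "locally_compact_space (subtopology X U)"
    using X U by (intro locally_compact_space_open_subset compact_imp_locally_compact_space) auto
  then have "locally_compact_space (prod_topology euclideanreal Y)"
    using strip homeomorphic_locally_compact_space by blast
  then have lc: "locally_compact_space Y"
    using nontrivial by (simp add: locally_compact_space_prod_topology)
  have "Hausdorff_space (subtopology X U)"
    using X(2) by (rule Hausdorff_space_subtopology)
  then have "Hausdorff_space (prod_topology euclideanreal Y)"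
    using strip homeomorphic_Hausdorff_space by blast
  then have "Hausdorff_space Y"
    using nontrivial by (simp add: Hausdorff_space_prod_topology)
  then obtain \<rho> :: "_ \<Rightarrow> real" and L where \<rho>: "continuous_map Y euclideanreal \<rho>"
    "\<And>z. z \<in> topspace Y \<Longrightarrow> 0 \<le> \<rho> z \<and> \<rho> z \<le> 1"
    "\<rho> y = 1" "compactin Y L" "\<And>z. z \<in> topspace Y - L \<Longrightarrow> \<rho> z = 0"
    using locally_compact_bump[OF lc _ y] by metis
  obtain \<psi> where \<psi>: "homeomorphic_map (prod_topology euclideanreal Y) (subtopology X U) \<psi>"
    using strip homeomorphic_space_sym homeomorphic_space by metis
  obtain h where h: "h \<in> carrier H" and h_nontrivial: "h \<noteq> \<one>\<^bsub>H\<^esub>"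
    using H group.is_monoid[OF H(1)] monoid.one_closed unfolding trivial_group_def by blast
  interpret continuous_action X Y U \<psi> \<rho> L y H h T
    using X U \<psi> y \<rho> H(1) h T
    by (intro continuous_action.intro flow_box.intro continuous_action_axioms.intro)
  show ?thesis
    using h_nontrivial by (rule not_Hausdorff)
qed

section \<open>Cubes, spheres and tori\<close>

lemma open_cube_enat: "open_cube (enat n) = product_topology (\<lambda>_. top_of_set {0<..<1}) {..<n}"
  by (simp add: open_cube_def lessThan_def)

lemma homeomorphic_space_product_topology:
  fixes I :: "'i set"
  assumes "\<And>i. i \<in> I \<Longrightarrow> X i homeomorphic_space Y i"
  shows "product_topology X I homeomorphic_space product_topology Y I"
proof -
  obtain f g where fg: "\<And>i. i \<in> I \<Longrightarrow> homeomorphic_maps (X i) (Y i) (f i) (g i)"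
    using assms unfolding homeomorphic_space_def by metis
  have coordinatewise: "continuous_map (product_topology A I) (product_topology B I)
      (\<lambda>x. \<lambda>i\<in>I. h i (x i))"
    if h: "\<And>i. i \<in> I \<Longrightarrow> continuous_map (A i) (B i) (h i)"
    for A :: "'i \<Rightarrow> 'c topology" and B :: "'i \<Rightarrow> 'd topology" and h
    unfolding continuous_map_componentwise
  proof (intro conjI ballI)
    fix k assume k: "k \<in> I"
    from continuous_map_compose[OF continuous_map_product_projection[OF k, of A] h[OF k]] k
    show "continuous_map (product_topology A I) (B k) (\<lambda>x. (\<lambda>i\<in>I. h i (x i)) k)"
      by (simp add: o_def)
  qed auto
  have "homeomorphic_maps (product_topology X I) (product_topology Y I)
      (\<lambda>x. \<lambda>i\<in>I. f i (x i)) (\<lambda>y. \<lambda>i\<in>I. g i (y i))"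
    unfolding homeomorphic_maps_def
  proof (intro conjI ballI)
    show "continuous_map (product_topology X I) (product_topology Y I) (\<lambda>x. \<lambda>i\<in>I. f i (x i))"
      using fg unfolding homeomorphic_maps_def by (intro coordinatewise) blast
    show "continuous_map (product_topology Y I) (product_topology X I) (\<lambda>y. \<lambda>i\<in>I. g i (y i))"
      using fg unfolding homeomorphic_maps_def by (intro coordinatewise) blast
  next
    fix x assume x: "x \<in> topspace (product_topology X I)"
    show "(\<lambda>i\<in>I. g i ((\<lambda>i\<in>I. f i (x i)) i)) = x"
    proof
      fix i show "(\<lambda>i\<in>I. g i ((\<lambda>i\<in>I. f i (x i)) i)) i = x i"
        using x fg[of i] unfolding homeomorphic_maps_def
        by (cases "i \<in> I") (auto simp: PiE_iff extensional_def)
    qed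
  next
    fix y assume y: "y \<in> topspace (product_topology Y I)"
    show "(\<lambda>i\<in>I. f i ((\<lambda>i\<in>I. g i (y i)) i)) = y"
    proof
      fix i show "(\<lambda>i\<in>I. f i ((\<lambda>i\<in>I. g i (y i)) i)) i = y i"
        using y fg[of i] unfolding homeomorphic_maps_def
        by (cases "i \<in> I") (auto simp: PiE_iff extensional_def)
    qed
  qed
  then show ?thesis by (rule homeomorphic_maps_imp_homeomorphic_space)
qed

lemma contains_open_cube_power:
  fixes n :: nat
  assumes n: "n > 0" and U: "openin X U" "subtopology X U homeomorphic_space top_of_set {0<..<1::real}"
  shows "contains_open_cube (product_topology (\<lambda>_. X) {..<n})"
proof -
  let ?P = "product_topology (\<lambda>_. X) {..<n}"
  have "openin ?P (\<Pi>\<^sub>E i\<in>{..<n}. U)"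
    using U(1) openin_PiE[of "{..<n}" "\<lambda>_. X" "\<lambda>_. U"] by simp
  moreover have "subtopology ?P (\<Pi>\<^sub>E i\<in>{..<n}. U) homeomorphic_space open_cube (enat n)"
    unfolding subtopology_product_topology open_cube_enat
    using U(2) by (intro homeomorphic_space_product_topology)
  moreover have "enat n \<noteq> 0"
    using n by (simp add: zero_enat_def)
  ultimately show ?thesis
    unfolding contains_open_cube_def by blast
qed

lemma closed_cube_example:
  assumes "n > 0"
  shows "compact_space (closed_cube n)" "Hausdorff_space (closed_cube n)" "contains_open_cube (closed_cube n)"
proof -
  have "compact_space (top_of_set {0..1::real})"
    using compact_space_subtopology[of euclideanreal "{0..1}"] by simp
  then show "compact_space (closed_cube n)"
    by (simp add: closed_cube_def compact_space_product_topology)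
  show "Hausdorff_space (closed_cube n)"
    by (simp add: closed_cube_def Hausdorff_space_product_topology Hausdorff_space_subtopology)
  have "openin (top_of_set {0..1}) {0<..<1::real}"
    by (rule open_subset) auto
  moreover have "subtopology (top_of_set {0..1}) {0<..<1::real} = top_of_set {0<..<1}"
    by (simp add: subtopology_subtopology) (rule arg_cong[of _ _ top_of_set], auto)
  ultimately show "contains_open_cube (closed_cube n)"
    unfolding closed_cube_def by (intro contains_open_cube_power[OF assms]) auto
qed

text \<open>The sphere is closed in the countable power of the line, and contained in the compact cube \<open>[-1, 1]\<^sup>\<omega>\<close>.\<close>

lemma compact_space_nsphere: "compact_space (nsphere n)"
proof -
  let ?R = "powertop_real (UNIV :: nat set)"
  let ?S = "{x :: nat \<Rightarrow> real. (\<Sum>i\<le>n. (x i)\<^sup>2) = 1 \<and> (\<forall>i>n. x i = 0)}"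
  have proj: "continuous_map ?R euclideanreal (\<lambda>x. x i)" for i
    by (rule continuous_map_product_projection) simp
  have "closedin ?R {x \<in> topspace ?R. (\<Sum>i\<le>n. (x i)\<^sup>2) \<in> {1}}"
    by (rule closedin_continuous_map_preimage[of _ euclideanreal])
      (auto intro!: continuous_map_sum continuous_map_real_pow proj)
  moreover have "closedin ?R (\<Inter>i\<in>{n<..}. {x \<in> topspace ?R. x i \<in> {0}})"
    by (intro closedin_INT closedin_continuous_map_preimage[OF proj]) auto
  ultimately have "closedin ?R ({x \<in> topspace ?R. (\<Sum>i\<le>n. (x i)\<^sup>2) \<in> {1}} \<inter>
      (\<Inter>i\<in>{n<..}. {x \<in> topspace ?R. x i \<in> {0}}))"
    by (rule closedin_Int)
  also have "\<dots> = ?S" by auto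
  finally have closed: "closedin ?R ?S" .
  have bounded: "?S \<subseteq> (\<Pi>\<^sub>E i\<in>UNIV. {-1..1})"
  proof
    fix x assume x: "x \<in> ?S"
    have "\<bar>x i\<bar> \<le> 1" for i
    proof (cases "i \<le> n")
      case True
      then have "(x i)\<^sup>2 \<le> (\<Sum>i\<le>n. (x i)\<^sup>2)" by (intro member_le_sum) auto
      then show ?thesis using x by (simp add: abs_square_le_1)
    qed (use x in simp)
    then show "x \<in> (\<Pi>\<^sub>E i\<in>UNIV. {-1..1})" by (auto simp: PiE_iff abs_le_iff minus_le_iff)
  qed
  have "compactin ?R (\<Pi>\<^sub>E i\<in>UNIV. {-1..1})" by (simp add: compactin_PiE)
  then have "compactin ?R ?S" using bounded closed by (rule closed_compactin)
  then show ?thesis unfolding nsphere by (rule compact_space_subtopology)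
qed

lemma Hausdorff_space_nsphere: "Hausdorff_space (nsphere n)"
  unfolding nsphere by (simp add: Hausdorff_space_subtopology Hausdorff_space_product_topology)

text \<open>Part of the open upper hemisphere \<open>x n > 0\<close> is the graph of a function over the cube \<open>(-c, c)\<^sup>n\<close>,
provided that the cube lies inside the open unit ball, as \<open>n c\<^sup>2 < 1\<close> ensures. The chart rescales that cube to
\<open>(0, 1)\<^sup>n\<close>.\<close>

lemma nsphere_contains_open_cube:
  obtains U where "openin (nsphere n) U" "subtopology (nsphere n) U homeomorphic_space open_cube (enat n)"
proof -
  define c where "c = 1 / (real n + 1)"
  have c: "0 < c" "real n * c\<^sup>2 < 1"
  proof -
    show "0 < c" by (simp add: c_def)
    have "c \<le> 1" by (auto simp: c_def field_simps)
    have "real n * c < 1" by (simp add: c_def)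
    then have "real n * c * c < 1"
      using \<open>0 < c\<close> \<open>c \<le> 1\<close> by (smt (verit) mult_left_le of_nat_0_le_iff mult_nonneg_nonneg)
    then show "real n * c\<^sup>2 < 1" by (simp add: power2_eq_square mult.assoc)
  qed
  let ?S = "nsphere n"
  let ?A = "\<lambda>i V. {x \<in> topspace ?S. x i \<in> V}"
  \<comment> \<open>For \<open>n = 0\<close> the intersection over \<open>i < n\<close> is the whole type, and has to be cut down to the sphere.\<close>
  define U where "U = ?A n {0<..} \<inter> ((\<Inter>i\<in>{..<n}. ?A i {-c<..<c}) \<inter> topspace ?S)"
  have coordinate: "openin ?S (?A i V)" if "open V" for i V
    using that by (intro openin_continuous_map_preimage[OF continuous_map_nsphere_projection]) simp
  have "openin ?S (?A n {0<..})"
    by (rule coordinate) simp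
  moreover have "openin ?S ((\<Inter>i\<in>{..<n}. ?A i {-c<..<c}) \<inter> topspace ?S)"
    by (intro openin_INT coordinate) auto
  ultimately have openU: "openin ?S U"
    unfolding U_def by (rule openin_Int)
  have U: "x \<in> U \<longleftrightarrow> x \<in> topspace ?S \<and> 0 < x n \<and> (\<forall>i<n. -c < x i \<and> x i < c)" for x
    by (auto simp: U_def)
  have in_S: "x \<in> topspace ?S \<longleftrightarrow> (\<Sum>i<n. (x i)\<^sup>2) + (x n)\<^sup>2 = 1 \<and> (\<forall>i>n. x i = 0)" for x
    by (simp add: nsphere flip: lessThan_Suc_atMost)
  let ?f = "\<lambda>x. \<lambda>i\<in>{..<n}. (x i / c + 1) / 2"
  let ?g = "\<lambda>y i. if i < n then c * (2 * y i - 1)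
      else if i = n then sqrt (1 - (\<Sum>j<n. (c * (2 * y j - 1))\<^sup>2)) else 0"
  have small: "(\<Sum>j<n. (c * (2 * y j - 1))\<^sup>2) < 1" if y: "y \<in> topspace (open_cube (enat n))" for y
  proof -
    have "(c * (2 * y j - 1))\<^sup>2 \<le> c\<^sup>2" if "j < n" for j
    proof -
      have "0 < y j" "y j < 1" using y that by (auto simp: open_cube_enat PiE_iff)
      then have "\<bar>2 * y j - 1\<bar> \<le> 1" by simp
      then have "(2 * y j - 1)\<^sup>2 \<le> 1" by (simp add: abs_square_le_1)
      then show ?thesis by (simp add: power_mult_distrib mult_left_le)
    qed
    then have "(\<Sum>j<n. (c * (2 * y j - 1))\<^sup>2) \<le> (\<Sum>j<n. c\<^sup>2)" by (intro sum_mono) auto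
    then show ?thesis using c(2) by simp
  qed
  have "homeomorphic_maps (subtopology ?S U) (open_cube (enat n)) ?f ?g"
    unfolding homeomorphic_maps_def
  proof (intro conjI ballI)
    have coord: "continuous_map (subtopology ?S U) euclideanreal (\<lambda>x. x i)" for i
      by (rule continuous_map_from_subtopology[OF continuous_map_nsphere_projection])
    show "continuous_map (subtopology ?S U) (open_cube (enat n)) ?f"
      unfolding open_cube_enat continuous_map_componentwise
    proof (intro conjI ballI)
      fix k assume k: "k \<in> {..<n}"
      have "continuous_map (subtopology ?S U) euclideanreal (\<lambda>x. (x k * (1 / c) + 1) * (1 / 2))"
        by (intro continuous_map_real_mult_right continuous_map_add coord) auto
      moreover have "(x k * (1 / c) + 1) * (1 / 2) \<in> {0<..<1}" if "x \<in> U" for x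
      proof -
        have "-1 < x k / c" "x k / c < 1" using that k c(1) by (auto simp: U field_simps)
        then show ?thesis by simp
      qed
      ultimately show "continuous_map (subtopology ?S U) (top_of_set {0<..<1}) (\<lambda>x. ?f x k)"
        using k by (auto simp: continuous_map_in_subtopology)
    qed auto
    have coord': "continuous_map (open_cube (enat n)) euclideanreal (\<lambda>y. y j)" if "j < n" for j
      using continuous_map_product_projection[of j "{..<n}" "\<lambda>_. top_of_set {0<..<1::real}"] that
      by (simp add: open_cube_enat continuous_map_in_subtopology)
    have "continuous_map (open_cube (enat n)) (powertop_real UNIV) ?g"
      unfolding continuous_map_componentwise_UNIV
    proof
      fix k
      have "continuous_map (open_cube (enat n)) euclideanreal (\<lambda>y. c * (2 * y j - 1))" if "j < n" for j
        by (intro continuous_map_real_mult_left continuous_map_diff coord' that) auto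
      then show "continuous_map (open_cube (enat n)) euclideanreal (\<lambda>y. ?g y k)"
        by (cases "k < n"; cases "k = n")
          (auto intro!: continuous_map_sqrt continuous_map_diff continuous_map_sum continuous_map_real_pow)
    qed
    moreover have g_in: "?g y \<in> U" if y: "y \<in> topspace (open_cube (enat n))" for y
    proof -
      have "-1 < 2 * y i - 1" "2 * y i - 1 < 1" if "i < n" for i
        using y that by (auto simp: open_cube_enat PiE_iff)
      then have "- c < c * (2 * y i - 1)" "c * (2 * y i - 1) < c" if "i < n" for i
        using that c(1) mult_strict_left_mono[of "-1" "2 * y i - 1" c]
          mult_strict_left_mono[of "2 * y i - 1" 1 c] by auto
      then show ?thesis using small[OF y] by (simp add: U in_S)
    qed
    ultimately show "continuous_map (open_cube (enat n)) (subtopology ?S U) ?g"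
      using openin_subset[OF openU] unfolding nsphere
      by (auto simp: continuous_map_in_subtopology)
  next
    fix x assume "x \<in> topspace (subtopology ?S U)"
    then have x: "x \<in> U" by simp
    show "?g (?f x) = x"
    proof
      fix i
      have cancel: "c * ((2 * x j / c + 2) / 2 - 1) = x j" for j
        using c(1) by (simp add: field_simps)
      have "1 - (\<Sum>j<n. (x j)\<^sup>2) = (x n)\<^sup>2" "0 < x n" "i > n \<Longrightarrow> x i = 0"
        using x by (auto simp: U in_S)
      then have "sqrt (1 - (\<Sum>j<n. (x j)\<^sup>2)) = x n" by simp
      then show "?g (?f x) i = x i"
        using x by (auto simp: cancel U in_S)
    qed
  next
    fix y assume y: "y \<in> topspace (open_cube (enat n))"
    show "?f (?g y) = y"
    proof
      fix i
      show "?f (?g y) i = y i"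
        using y c(1) by (cases "i < n") (auto simp: open_cube_enat PiE_iff extensional_def)
    qed
  qed
  then show ?thesis
    using that[OF openU] homeomorphic_maps_imp_homeomorphic_space by blast
qed

lemma nsphere_example:
  assumes "n > 0"
  shows "contains_open_cube (nsphere n)"
proof -
  have "enat n \<noteq> 0" using assms by (simp add: zero_enat_def)
  then show ?thesis
    unfolding contains_open_cube_def by (metis nsphere_contains_open_cube)
qed

lemma torus_example:
  assumes "n > 0"
  shows "compact_space (torus n)" "Hausdorff_space (torus n)" "contains_open_cube (torus n)"
proof -
  show "compact_space (torus n)" "Hausdorff_space (torus n)"
    by (simp_all add: torus_def compact_space_product_topology compact_space_nsphere
        Hausdorff_space_product_topology Hausdorff_space_nsphere)
  obtain U where U: "openin (nsphere 1) U" "subtopology (nsphere 1) U homeomorphic_space open_cube (enat 1)"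
    by (rule nsphere_contains_open_cube)
  note U(2)
  also have "open_cube (enat 1) homeomorphic_space top_of_set {0<..<1::real}"
    using homeomorphic_space_singleton_product[of "\<lambda>_. top_of_set {0<..<1::real}" "0::nat"]
    by (simp add: open_cube_enat lessThan_Suc)
  finally show "contains_open_cube (torus n)"
    unfolding torus_def by (rule contains_open_cube_power[OF assms U(1)])
qed

section \<open>Non-existence of a Hausdorff group topology\<close>

theorem proposition3p8:
  shows "(\<forall>(H :: ('h, 'm) monoid_scheme) (X :: 'a topology).
      group H \<and> \<not> trivial_group H \<and>
      compact_space X \<and> Hausdorff_space X \<and> contains_open_cube X \<longrightarrow>
      \<not> (\<exists>T. Hausdorff_space T \<and> group_topology (copies_sum H X) T \<and>
            continuous_map (prod_topology (Homeo_topology X) T) T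
              (\<lambda>(g, u). translate X g u)))
    \<and> (\<forall>n>0.
      (compact_space (closed_cube n) \<and> Hausdorff_space (closed_cube n) \<and>
        contains_open_cube (closed_cube n)) \<and>
      (compact_space (nsphere n) \<and> Hausdorff_space (nsphere n) \<and>
        contains_open_cube (nsphere n)) \<and>
      (compact_space (torus n) \<and> Hausdorff_space (torus n) \<and>
        contains_open_cube (torus n)))"
proof (intro conjI allI impI)
  fix H :: "('h, 'm) monoid_scheme" and X :: "'a topology"
  assume asm: "group H \<and> \<not> trivial_group H \<and>
      compact_space X \<and> Hausdorff_space X \<and> contains_open_cube X"
  then obtain n U where n: "n \<noteq> 0" and U: "openin X U"
    "subtopology X U homeomorphic_space open_cube n"
    unfolding contains_open_cube_def by blast
  obtain Y :: "(nat \<Rightarrow> real) topology" where Y: "topspace Y \<noteq> {}"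
    "open_cube n homeomorphic_space prod_topology euclideanreal Y"
    using open_cube_homeomorphic_strip[OF n] .
  have "subtopology X U homeomorphic_space prod_topology euclideanreal Y"
    using U(2) Y(2) by (rule homeomorphic_space_trans)
  then show "\<not> (\<exists>T. Hausdorff_space T \<and> group_topology (copies_sum H X) T \<and>
      continuous_map (prod_topology (Homeo_topology X) T) T (\<lambda>(g, u). translate X g u))"
    using no_Hausdorff_group_topology[OF _ _ _ _ U(1) _ Y(1)] asm by blast
qed (use closed_cube_example torus_example nsphere_example compact_space_nsphere
    Hausdorff_space_nsphere in auto)

end
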